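(* Let $\mathsf n\ge1$ and $\mathsf f\ge 2$ be integers and let $(\mathfrak A,\mathfrak B)$ be an access structure on $[\mathsf n]$ with $\mathfrak A\ne\emptyset$. If there is an $(\mathfrak A,\mathfrak B,\mathsf n,\mathsf f)$-CSSPIR protocol with PIR rate $R_{\mathrm{PIR}}$ and shared randomness rate $\rho$, then the SS rate $R_{\mathrm{PIR}}$ is achievable for $(\mathfrak A,\mathfrak B,\mathsf n)$-CSNSS with randomness rate $\rho$; that is, there is a sequence of $(\mathfrak A,\mathfrak B,\mathsf n)$-CSNSS protocols, each with randomness rate $\rho$, whose secret sizes $|\mathcal M|$ tend to infinity and whose SS rates converge to $R_{\mathrm{PIR}}$.
   Context: Notation: $[n]=\{1,\dots,n\}$; for a tuple $A=(A_1,\dots,A_n)$ and $\mathcal X\subset[n]$, $A_{\mathcal X}=(A_i)_{i\in\mathcal X}$. $I(\cdot;\cdot)$ is mutual information. Access structure on $[\mathsf n]$: a pair $(\mathfrak A,\mathfrak B)$ of subsets of $2^{[\mathsf n]}$ with $\mathfrak A$ closed under supersets, $\mathfrak B$ closed under subsets, and $\mathfrak A\cap\mathfrak B=\emptyset$. SPIR protocol ($\mathsf n$ servers, $\mathsf f$ files). Data: finite sets $\mathcal M$ (files, $|\mathcal M|\ge2$), $\mathcal U$ (random seeds), $\mathcal R$ (user randomness), $\mathcal T_j,\mathcal Q_j,\mathcal D_j$ ($j\in[\mathsf n]$), and deterministic maps $h:\mathcal U\to\prod_j\mathcal T_j$, $\phi:[\mathsf f]\times\mathcal R\to\prod_j\mathcal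 Q_j$, $g_j:\mathcal Q_j\times\mathcal M^{\mathsf f}\times\mathcal T_j\to\mathcal D_j$. The random variables $M=(M_1,\dots,M_{\mathsf f})\in\mathcal M^{\mathsf f}$, $U\in\mathcal U$, $K\in[\mathsf f]$, $R\in\mathcal R$ are uniform and mutually independent; $T=h(U)$, $Q=\phi(K,R)$, $D_j=g_j(Q_j,M,T_j)$, $D=(D_1,\dots,D_{\mathsf n})$. It is an $(\mathfrak A,\mathfrak B,\mathsf n,\mathsf f)$-CSSPIR protocol (completely secure SPIR) if: - Correctness: for all $r\in\mathcal R$, $k\in[\mathsf f]$, $\mathcal A\in\mathfrak A$, given $K=k,R=r$ the maximum likelihood decoder of $M_k$ from $D_{\mathcal A}$ has error probability $0$ (i.e. $M_k$ is a function of $D_{\mathcal A}$). - Server secrecy: $I(D;M_{[\mathsf f]\setminus\{k\}}\mid R=r,K=k)=0$ for all $r,k$. - User secrecy: $I(K;Q_{\mathcal B})=0$ for all $\mathcal B\in\mathfrak B$. The PIR rate is $\log|\mathcal M|/\sum_j\log|\mathcal D_j|$; the shared randomness rate is $\log|\mathcal U|/\log|\mathcal M|$. NSS protocol ($\mathsf n$ players): finite sets $\mathcal M$ (secrets, $|\mathcal M|\ge2$), $\mathcal U$, $\mathcal S_1,\dots,\mathcal S_{\mathsf n}$ and a map $\psi:\mathcal M\times\mathcal U\to\prod_j\mathcal S_j$; $L\in\mathcal M$ and $U\in\mathcal U$ are independent and uniform, and the shares are $(S_1,\dots,S_{\mathsf n})=\psi(L,U)$. It is an $(\mathfrak A,\mathfrak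 B,\mathsf n)$-CSNSS protocol (completely secure) if for every $\mathcal A\in\mathfrak A$ the maximum likelihood decoder of $L$ from $S_{\mathcal A}$ has error probability $0$ (i.e. $L$ is a function of $S_{\mathcal A}$), and $I(L;S_{\mathcal B})=0$ for every $\mathcal B\in\mathfrak B$. The SS rate is $\log|\mathcal M|/\sum_j\log|\mathcal S_j|$; the randomness rate is $\log|\mathcal U|/\log|\mathcal M|$. *)

theory Defs
  imports "HOL-Probability.Information"
begin

section \<open>Random variables on finite spaces\<close>

abbreviation mutual_info :: "'w measure \<Rightarrow> ('w \<Rightarrow> 'x) \<Rightarrow> ('w \<Rightarrow> 'y) \<Rightarrow> real" where
  "mutual_info P X Y \<equiv> prob_space.mutual_information P 2
     (count_space (X ` space P)) (count_space (Y ` space P)) X Y"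

text \<open>
  The maximum likelihood decoder of \<open>X\<close>, which takes values in \<open>V\<close>, from \<open>Y\<close>.  Ties are broken
  arbitrarily; all applications have \<open>X\<close> uniformly distributed on \<open>V\<close>, in which case the error
  probability does not depend on how this is done.
\<close>

definition ml_decoder :: "'w measure \<Rightarrow> 'x set \<Rightarrow> ('w \<Rightarrow> 'x) \<Rightarrow> ('w \<Rightarrow> 'y) \<Rightarrow> 'y \<Rightarrow> 'x" where
  "ml_decoder P V X Y y = (ARG_MAX (\<lambda>x. \<P>(\<omega> in P. Y \<omega> = y \<bar> X \<omega> = x)) x. x \<in> V)"

definition ml_error :: "'w measure \<Rightarrow> 'x set \<Rightarrow> ('w \<Rightarrow> 'x) \<Rightarrow> ('w \<Rightarrow> 'y) \<Rightarrow> real" where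
  "ml_error P V X Y = \<P>(\<omega> in P. ml_decoder P V X Y (Y \<omega>) \<noteq> X \<omega>)"

section \<open>Access structures\<close>

definition access_structure :: "nat \<Rightarrow> nat set set \<Rightarrow> nat set set \<Rightarrow> bool" where
  "access_structure n \<AA> \<BB> \<longleftrightarrow>
     \<AA> \<subseteq> Pow {1..n} \<and> \<BB> \<subseteq> Pow {1..n} \<and>
     (\<forall>A\<in>\<AA>. \<forall>A'. A \<subseteq> A' \<and> A' \<subseteq> {1..n} \<longrightarrow> A' \<in> \<AA>) \<and>
     (\<forall>B\<in>\<BB>. \<forall>B'. B' \<subseteq> B \<longrightarrow> B' \<in> \<BB>) \<and>
     \<AA> \<inter> \<BB> = {}"

section \<open>Symmetric private information retrieval\<close>

text \<open>
  Tuples indexed by \<open>[n]\<close> or \<open>[f]\<close> are extensional functions on \<open>{1..n}\<close> or \<open>{1..f}\<close>, and the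
  subtuple of a tuple for an index set is its restriction to that set.
\<close>

record ('m, 'u, 'r, 't, 'q, 'd) spir =
  files :: "'m set"
  seeds :: "'u set"
  user_rand :: "'r set"
  server_rand :: "nat \<Rightarrow> 't set"
  queries :: "nat \<Rightarrow> 'q set"
  answers :: "nat \<Rightarrow> 'd set"
  distribute :: "'u \<Rightarrow> nat \<Rightarrow> 't"
  query :: "nat \<Rightarrow> 'r \<Rightarrow> nat \<Rightarrow> 'q"
  answer :: "nat \<Rightarrow> 'q \<Rightarrow> (nat \<Rightarrow> 'm) \<Rightarrow> 't \<Rightarrow> 'd"

definition spir_protocol :: "nat \<Rightarrow> nat \<Rightarrow> ('m, 'u, 'r, 't, 'q, 'd) spir \<Rightarrow> bool" where
  "spir_protocol n f \<Gamma> \<longleftrightarrow>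
     finite (files \<Gamma>) \<and> card (files \<Gamma>) \<ge> 2 \<and>
     finite (seeds \<Gamma>) \<and> seeds \<Gamma> \<noteq> {} \<and>
     finite (user_rand \<Gamma>) \<and> user_rand \<Gamma> \<noteq> {} \<and>
     (\<forall>j\<in>{1..n}. finite (server_rand \<Gamma> j) \<and> finite (queries \<Gamma> j) \<and> finite (answers \<Gamma> j)) \<and>
     (\<forall>u\<in>seeds \<Gamma>. distribute \<Gamma> u \<in> (\<Pi>\<^sub>E j\<in>{1..n}. server_rand \<Gamma> j)) \<and>
     (\<forall>k\<in>{1..f}. \<forall>r\<in>user_rand \<Gamma>. query \<Gamma> k r \<in> (\<Pi>\<^sub>E j\<in>{1..n}. queries \<Gamma> j)) \<and>
     (\<forall>j\<in>{1..n}. \<forall>q\<in>queries \<Gamma> j. \<forall>m\<in>({1..f} \<rightarrow>\<^sub>E files \<Gamma>). \<forall>t\<in>server_rand \<Gamma> j.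
        answer \<Gamma> j q m t \<in> answers \<Gamma> j)"

text \<open>An outcome is a quadruple \<open>(m, u, k, r)\<close> of values of \<open>M\<close>, \<open>U\<close>, \<open>K\<close> and \<open>R\<close>.\<close>

type_synonym ('m, 'u, 'r) outcome = "(nat \<Rightarrow> 'm) \<times> 'u \<times> nat \<times> 'r"

definition spir_space ::
    "nat \<Rightarrow> ('m, 'u, 'r, 't, 'q, 'd) spir \<Rightarrow> ('m, 'u, 'r) outcome measure" where
  "spir_space f \<Gamma> =
     uniform_count_measure (({1..f} \<rightarrow>\<^sub>E files \<Gamma>) \<times> seeds \<Gamma> \<times> {1..f} \<times> user_rand \<Gamma>)"

definition file_tuple :: "('m, 'u, 'r) outcome \<Rightarrow> nat \<Rightarrow> 'm" where
  "file_tuple = (\<lambda>(m, u, k, r). m)"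

definition file_index :: "('m, 'u, 'r) outcome \<Rightarrow> nat" where
  "file_index = (\<lambda>(m, u, k, r). k)"

definition user_randomness :: "('m, 'u, 'r) outcome \<Rightarrow> 'r" where
  "user_randomness = (\<lambda>(m, u, k, r). r)"

definition query_tuple ::
    "('m, 'u, 'r, 't, 'q, 'd) spir \<Rightarrow> ('m, 'u, 'r) outcome \<Rightarrow> nat \<Rightarrow> 'q" where
  "query_tuple \<Gamma> = (\<lambda>(m, u, k, r). query \<Gamma> k r)"

definition answer_tuple ::
    "nat \<Rightarrow> ('m, 'u, 'r, 't, 'q, 'd) spir \<Rightarrow> ('m, 'u, 'r) outcome \<Rightarrow> nat \<Rightarrow> 'd" where
  "answer_tuple n \<Gamma> = (\<lambda>(m, u, k, r).
     \<lambda>j\<in>{1..n}. answer \<Gamma> j (query \<Gamma> k r j) m (distribute \<Gamma> u j))"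

text \<open>The probability space conditioned on \<open>K = k\<close> and \<open>R = r\<close>.\<close>

definition spir_cond_space ::
    "nat \<Rightarrow> ('m, 'u, 'r, 't, 'q, 'd) spir \<Rightarrow> nat \<Rightarrow> 'r \<Rightarrow> ('m, 'u, 'r) outcome measure" where
  "spir_cond_space f \<Gamma> k r = uniform_measure (spir_space f \<Gamma>)
     {\<omega> \<in> space (spir_space f \<Gamma>). file_index \<omega> = k \<and> user_randomness \<omega> = r}"

definition spir_correct ::
    "nat set set \<Rightarrow> nat \<Rightarrow> nat \<Rightarrow> ('m, 'u, 'r, 't, 'q, 'd) spir \<Rightarrow> bool" where
  "spir_correct \<AA> n f \<Gamma> \<longleftrightarrow> (\<forall>r\<in>user_rand \<Gamma>. \<forall>k\<in>{1..f}. \<forall>A\<in>\<AA>.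
     ml_error (spir_cond_space f \<Gamma> k r) (files \<Gamma>)
       (\<lambda>\<omega>. file_tuple \<omega> k) (\<lambda>\<omega>. restrict (answer_tuple n \<Gamma> \<omega>) A) = 0)"

definition spir_server_secret ::
    "nat \<Rightarrow> nat \<Rightarrow> ('m, 'u, 'r, 't, 'q, 'd) spir \<Rightarrow> bool" where
  "spir_server_secret n f \<Gamma> \<longleftrightarrow> (\<forall>r\<in>user_rand \<Gamma>. \<forall>k\<in>{1..f}.
     mutual_info (spir_cond_space f \<Gamma> k r)
       (answer_tuple n \<Gamma>) (\<lambda>\<omega>. restrict (file_tuple \<omega>) ({1..f} - {k})) = 0)"

definition spir_user_secret ::
    "nat set set \<Rightarrow> nat \<Rightarrow> ('m, 'u, 'r, 't, 'q, 'd) spir \<Rightarrow> bool" where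
  "spir_user_secret \<BB> f \<Gamma> \<longleftrightarrow> (\<forall>B\<in>\<BB>.
     mutual_info (spir_space f \<Gamma>) file_index (\<lambda>\<omega>. restrict (query_tuple \<Gamma> \<omega>) B) = 0)"

definition csspir ::
    "nat set set \<Rightarrow> nat set set \<Rightarrow> nat \<Rightarrow> nat \<Rightarrow> ('m, 'u, 'r, 't, 'q, 'd) spir \<Rightarrow> bool" where
  "csspir \<AA> \<BB> n f \<Gamma> \<longleftrightarrow> spir_protocol n f \<Gamma> \<and>
     spir_correct \<AA> n f \<Gamma> \<and> spir_server_secret n f \<Gamma> \<and> spir_user_secret \<BB> f \<Gamma>"

definition pir_rate :: "nat \<Rightarrow> ('m, 'u, 'r, 't, 'q, 'd) spir \<Rightarrow> real" where
  "pir_rate n \<Gamma> = log 2 (card (files \<Gamma>)) / (\<Sum>j=1..n. log 2 (card (answers \<Gamma> j)))"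

definition shared_randomness_rate :: "('m, 'u, 'r, 't, 'q, 'd) spir \<Rightarrow> real" where
  "shared_randomness_rate \<Gamma> = log 2 (card (seeds \<Gamma>)) / log 2 (card (files \<Gamma>))"

section \<open>Secret sharing\<close>

record ('m, 'u, 's) nss =
  secrets :: "'m set"
  rand :: "'u set"
  shares :: "nat \<Rightarrow> 's set"
  share :: "'m \<Rightarrow> 'u \<Rightarrow> nat \<Rightarrow> 's"

definition nss_protocol :: "nat \<Rightarrow> ('m, 'u, 's) nss \<Rightarrow> bool" where
  "nss_protocol n \<Psi> \<longleftrightarrow>
     finite (secrets \<Psi>) \<and> card (secrets \<Psi>) \<ge> 2 \<and>
     finite (rand \<Psi>) \<and> rand \<Psi> \<noteq> {} \<and>
     (\<forall>j\<in>{1..n}. finite (shares \<Psi> j)) \<and>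
     (\<forall>l\<in>secrets \<Psi>. \<forall>u\<in>rand \<Psi>. share \<Psi> l u \<in> (\<Pi>\<^sub>E j\<in>{1..n}. shares \<Psi> j))"

text \<open>An outcome is a pair \<open>(l, u)\<close> of values of the secret \<open>L\<close> and of \<open>U\<close>.\<close>

definition nss_space :: "('m, 'u, 's) nss \<Rightarrow> ('m \<times> 'u) measure" where
  "nss_space \<Psi> = uniform_count_measure (secrets \<Psi> \<times> rand \<Psi>)"

definition share_tuple :: "('m, 'u, 's) nss \<Rightarrow> 'm \<times> 'u \<Rightarrow> nat \<Rightarrow> 's" where
  "share_tuple \<Psi> = (\<lambda>(l, u). share \<Psi> l u)"

definition nss_correct :: "nat set set \<Rightarrow> ('m, 'u, 's) nss \<Rightarrow> bool" where
  "nss_correct \<AA> \<Psi> \<longleftrightarrow> (\<forall>A\<in>\<AA>.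
     ml_error (nss_space \<Psi>) (secrets \<Psi>) fst (\<lambda>\<omega>. restrict (share_tuple \<Psi> \<omega>) A) = 0)"

definition nss_secret :: "nat set set \<Rightarrow> ('m, 'u, 's) nss \<Rightarrow> bool" where
  "nss_secret \<BB> \<Psi> \<longleftrightarrow> (\<forall>B\<in>\<BB>.
     mutual_info (nss_space \<Psi>) fst (\<lambda>\<omega>. restrict (share_tuple \<Psi> \<omega>) B) = 0)"

definition csnss :: "nat set set \<Rightarrow> nat set set \<Rightarrow> nat \<Rightarrow> ('m, 'u, 's) nss \<Rightarrow> bool" where
  "csnss \<AA> \<BB> n \<Psi> \<longleftrightarrow> nss_protocol n \<Psi> \<and> nss_correct \<AA> \<Psi> \<and> nss_secret \<BB> \<Psi>"

definition ss_rate :: "nat \<Rightarrow> ('m, 'u, 's) nss \<Rightarrow> real" where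
  "ss_rate n \<Psi> = log 2 (card (secrets \<Psi>)) / (\<Sum>j=1..n. log 2 (card (shares \<Psi> j)))"

definition randomness_rate :: "('m, 'u, 's) nss \<Rightarrow> real" where
  "randomness_rate \<Psi> = log 2 (card (rand \<Psi>)) / log 2 (card (secrets \<Psi>))"

text \<open>
  As every finite set is in bijection with a set of natural numbers, it loses no generality to
  take the secrets, seeds and shares of the protocols in the sequence to be natural numbers.
\<close>

definition ss_rate_achievable ::
    "nat set set \<Rightarrow> nat set set \<Rightarrow> nat \<Rightarrow> real \<Rightarrow> real \<Rightarrow> bool" where
  "ss_rate_achievable \<AA> \<BB> n \<rho> R \<longleftrightarrow> (\<exists>\<Psi> :: nat \<Rightarrow> (nat, nat, nat) nss.
     (\<forall>i. csnss \<AA> \<BB> n (\<Psi> i) \<and> randomness_rate (\<Psi> i) = \<rho>) \<and>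
     filterlim (\<lambda>i. card (secrets (\<Psi> i))) at_top sequentially \<and>
     (\<lambda>i. ss_rate n (\<Psi> i)) \<longlonglongrightarrow> R)"

end

theory Submission
  imports Defs
begin

text \<open>
  Fix the user randomness \<open>r\<close> and all files but the first, and share a secret \<open>l\<close> as the answers to
  a query for the first file, with \<open>l\<close> as that file.  Correctness of the retrieval recovers \<open>l\<close>.
  For \<open>B \<in> \<BB>\<close>, user secrecy yields some \<open>r'\<close> for which the query for the second file looks the same
  to the servers in \<open>B\<close>; by server secrecy the answers to that query have a distribution that
  depends on the second file only, hence not on \<open>l\<close>.  The rates of this scheme are those of the
  retrieval protocol, and its powers have the same rates with arbitrarily large secrets.
\<close>

section \<open>Finite probability spaces\<close>

text \<open>Mutual information is the divergence of the joint law \<open>?Q\<close> from the product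
  \<open>?P\<close> of the marginals, so it vanishes exactly when \<open>?Q = ?P\<close>. On finite
  ranges this equality is tested on singletons.\<close>

lemma (in prob_space) mutual_info_eq_0_iff:
  fixes X :: "'a \<Rightarrow> 'x" and Y :: "'a \<Rightarrow> 'y"
  assumes fin: "finite (space M)" and sets: "sets M = Pow (space M)"
  shows "mutual_info M X Y = 0 \<longleftrightarrow>
    (\<forall>x y. \<P>(\<omega> in M. X \<omega> = x \<and> Y \<omega> = y) = \<P>(\<omega> in M. X \<omega> = x) * \<P>(\<omega> in M. Y \<omega> = y))"
proof -
  define S where "S = count_space (X ` space M)"
  define T where "T = count_space (Y ` space M)"
  have meas: "f \<in> measurable M N" if "f \<in> space M \<rightarrow> space N" for f :: "'a \<Rightarrow> 'c" and N
    using that by (auto simp: measurable_def sets)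
  have X: "random_variable S X" and Y: "random_variable T Y"
    by (auto intro!: meas simp: S_def T_def)
  have ST: "S \<Otimes>\<^sub>M T = count_space (X ` space M \<times> Y ` space M)"
    unfolding S_def T_def by (intro pair_measure_count_space) (auto simp: fin)
  then have setsST: "sets (S \<Otimes>\<^sub>M T) = Pow (X ` space M \<times> Y ` space M)"
    and spaceST: "space (S \<Otimes>\<^sub>M T) = X ` space M \<times> Y ` space M"
    by (metis sets_count_space, metis space_count_space)
  have XY: "random_variable (S \<Otimes>\<^sub>M T) (\<lambda>\<omega>. (X \<omega>, Y \<omega>))"
    using X Y by (rule measurable_Pair)
  let ?P = "distr M S X \<Otimes>\<^sub>M distr M T Y"
  let ?Q = "distr M (S \<Otimes>\<^sub>M T) (\<lambda>\<omega>. (X \<omega>, Y \<omega>))"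
  interpret X: prob_space "distr M S X" using X by (rule prob_space_distr)
  interpret Y: prob_space "distr M T Y" using Y by (rule prob_space_distr)
  interpret XY: pair_prob_space "distr M S X" "distr M T Y" by standard
  interpret P: information_space ?P 2 by standard simp
  interpret Q: prob_space ?Q using XY by (rule prob_space_distr)
  have setsP: "sets ?P = Pow (X ` space M \<times> Y ` space M)"
  proof -
    have "sets ?P = sets (S \<Otimes>\<^sub>M T)" by (intro sets_pair_measure_cong) auto
    then show ?thesis by (simp only: setsST)
  qed
  have distr: "emeasure (distr M N Z) {z} = ennreal \<P>(\<omega> in M. Z \<omega> = z)"
    if "random_variable N Z" "{z} \<in> sets N" for Z :: "'a \<Rightarrow> 'c" and N z
  proof -
    have "Z -` {z} \<inter> space M = {\<omega> \<in> space M. Z \<omega> = z}" by auto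
    then show ?thesis using that by (simp add: emeasure_distr emeasure_eq_measure)
  qed
  have P1: "emeasure ?P {(x, y)} = ennreal (\<P>(\<omega> in M. X \<omega> = x) * \<P>(\<omega> in M. Y \<omega> = y))"
    if "x \<in> X ` space M" "y \<in> Y ` space M" for x y
  proof -
    have xy: "{x} \<in> sets S" "{y} \<in> sets T" using that by (auto simp: S_def T_def)
    then have "emeasure ?P ({x} \<times> {y}) = emeasure (distr M S X) {x} * emeasure (distr M T Y) {y}"
      by (intro Y.emeasure_pair_measure_Times) auto
    then show ?thesis
      using distr[OF X xy(1)] distr[OF Y xy(2)] by (simp add: ennreal_mult)
  qed
  have Q1: "emeasure ?Q {(x, y)} = ennreal (\<P>(\<omega> in M. X \<omega> = x \<and> Y \<omega> = y))"
    if "x \<in> X ` space M" "y \<in> Y ` space M" for x y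
  proof -
    have "{(x, y)} \<in> sets (S \<Otimes>\<^sub>M T)" using that by (simp add: setsST)
    from distr[OF XY this] show ?thesis by simp
  qed
  have le: "\<P>(\<omega> in M. X \<omega> = x \<and> Y \<omega> = y) \<le> \<P>(\<omega> in M. X \<omega> = x)"
    "\<P>(\<omega> in M. X \<omega> = x \<and> Y \<omega> = y) \<le> \<P>(\<omega> in M. Y \<omega> = y)" for x y
    by (auto intro!: finite_measure_mono simp: sets)
  \<comment> \<open>A point mass of the joint law is bounded by both marginal masses
    (\<open>le\<close>), so it is 0 wherever their product is 0. A null set is a finite union of
    such points.\<close>
  have "absolutely_continuous ?P ?Q"
    unfolding absolutely_continuous_def
  proof
    fix A assume A: "A \<in> null_sets ?P"
    then have sub: "A \<subseteq> X ` space M \<times> Y ` space M" using setsP null_setsD2 by blast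
    have "{a} \<in> null_sets ?Q" if a_in: "a \<in> A" for a
    proof -
      obtain x y where a: "a = (x, y)" "x \<in> X ` space M" "y \<in> Y ` space M"
        using subsetD[OF sub a_in] by (elim SigmaE)
      have "{a} \<in> sets ?P" unfolding setsP using a by simp
      then have "{a} \<in> null_sets ?P" using a_in by (intro null_sets_subset[OF A]) simp_all
      then have "\<P>(\<omega> in M. X \<omega> = x) * \<P>(\<omega> in M. Y \<omega> = y) = 0"
        using P1[OF a(2,3)] by (simp add: null_setsD1 a(1))
      then have "\<P>(\<omega> in M. X \<omega> = x \<and> Y \<omega> = y) = 0"
        using le[of x y] by (auto intro: antisym)
      then show ?thesis
        using Q1[OF a(2,3)] a by (intro null_setsI) (simp_all add: setsST)
    qed
    moreover have "finite A" by (rule finite_subset[OF sub]) (simp add: fin)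
    ultimately have "(\<Union>a\<in>A. {a}) \<in> null_sets ?Q"
      by (intro null_sets_UN') (simp_all add: countable_finite)
    then show "A \<in> null_sets ?Q" by simp
  qed
  \<comment> \<open>The density takes finitely many values on the finite product of the ranges, so
    its maximum is a bound.\<close>
  moreover have "integrable ?Q (entropy_density 2 ?P ?Q)"
  proof (rule Q.integrable_const_bound)
    show "AE a in ?Q. norm (entropy_density 2 ?P ?Q a) \<le>
        Max ((\<lambda>a. norm (entropy_density 2 ?P ?Q a)) ` (X ` space M \<times> Y ` space M))"
      using fin by (intro AE_I2 Max_ge) (auto simp: spaceST)
    show "entropy_density 2 ?P ?Q \<in> borel_measurable ?Q"
      by (simp add: setsST spaceST measurable_def)
  qed
  moreover have "sets ?Q = sets ?P" using setsP setsST by (simp only: sets_distr)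
  ultimately have "mutual_info M X Y = 0 \<longleftrightarrow> ?Q = ?P"
    unfolding mutual_information_def S_def[symmetric] T_def[symmetric]
    by (intro P.KL_eq_0_iff_eq_ac Q.prob_space_axioms)
  also have "\<dots> \<longleftrightarrow> ?P = ?Q" by (rule eq_commute)
  also have "\<dots> \<longleftrightarrow> (\<forall>x\<in>X ` space M. \<forall>y\<in>Y ` space M.
      \<P>(\<omega> in M. X \<omega> = x \<and> Y \<omega> = y) = \<P>(\<omega> in M. X \<omega> = x) * \<P>(\<omega> in M. Y \<omega> = y))"
    (is "_ \<longleftrightarrow> ?R")
  proof
    assume "?P = ?Q"
    show ?R
    proof (intro ballI)
      fix x y assume "x \<in> X ` space M" "y \<in> Y ` space M"
      then show "\<P>(\<omega> in M. X \<omega> = x \<and> Y \<omega> = y) = \<P>(\<omega> in M. X \<omega> = x) * \<P>(\<omega> in M. Y \<omega> = y)"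
        using P1[of x y] Q1[of x y] \<open>?P = ?Q\<close> by simp
    qed
  next
    assume R: ?R
    show "?P = ?Q"
    proof (rule measure_eqI_finite)
      show "sets ?Q = Pow (X ` space M \<times> Y ` space M)" by (simp add: setsST)
      show "emeasure ?P {a} = emeasure ?Q {a}" if a_in: "a \<in> X ` space M \<times> Y ` space M" for a
      proof -
        obtain x y where a: "a = (x, y)" "x \<in> X ` space M" "y \<in> Y ` space M"
          using a_in by (elim SigmaE)
        show ?thesis using R a(2,3) by (simp only: a(1) P1 Q1)
      qed
      show "sets ?P = Pow (X ` space M \<times> Y ` space M)" by (rule setsP)
    qed (simp add: fin)
  qed
  \<comment> \<open>For a value outside one of the ranges, both sides are 0.\<close>
  also have "\<dots> \<longleftrightarrow> (\<forall>x y.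
      \<P>(\<omega> in M. X \<omega> = x \<and> Y \<omega> = y) = \<P>(\<omega> in M. X \<omega> = x) * \<P>(\<omega> in M. Y \<omega> = y))"
  proof (intro iffI allI)
    fix x y assume R: ?R
    show "\<P>(\<omega> in M. X \<omega> = x \<and> Y \<omega> = y) = \<P>(\<omega> in M. X \<omega> = x) * \<P>(\<omega> in M. Y \<omega> = y)"
    proof (cases "x \<in> X ` space M \<and> y \<in> Y ` space M")
      case False
      then have "{\<omega> \<in> space M. X \<omega> = x} = {} \<or> {\<omega> \<in> space M. Y \<omega> = y} = {}" by auto
      then have "\<P>(\<omega> in M. X \<omega> = x) = 0 \<or> \<P>(\<omega> in M. Y \<omega> = y) = 0" by (metis measure_empty)
      with le[of x y] show ?thesis by (auto intro: antisym)
    qed (use R in auto)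
  qed auto
  finally show ?thesis .
qed

text \<open>
  \<open>E\<close> may be smaller than the sample space: conditioning with \<^const>\<open>uniform_measure\<close> keeps the
  sample space and only moves the mass.
\<close>

definition uniform_on :: "'a measure \<Rightarrow> 'a set \<Rightarrow> bool" where
  "uniform_on P E \<longleftrightarrow> finite (space P) \<and> sets P = Pow (space P) \<and> E \<subseteq> space P \<and> E \<noteq> {} \<and>
     (\<forall>A\<subseteq>space P. measure P A = card (A \<inter> E) / card E) \<and> prob_space P"

lemma uniform_on_uniform_count_measure:
  assumes "finite \<Omega>" "\<Omega> \<noteq> {}"
  shows "uniform_on (uniform_count_measure \<Omega>) \<Omega>"
proof -
  have "measure (uniform_count_measure \<Omega>) A = card (A \<inter> \<Omega>) / card \<Omega>" if "A \<subseteq> \<Omega>" for A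
    using assms(1) that by (simp add: measure_uniform_count_measure Int_absorb2)
  then show ?thesis
    using assms prob_space_uniform_count_measure[OF assms]
    by (simp add: uniform_on_def space_uniform_count_measure sets_uniform_count_measure)
qed

lemma uniform_on_cond:
  assumes fin: "finite \<Omega>" and E: "E \<subseteq> \<Omega>" "E \<noteq> {}"
  shows "uniform_on (uniform_measure (uniform_count_measure \<Omega>) E) E"
proof -
  let ?M = "uniform_count_measure \<Omega>"
  have E': "finite E" using fin E finite_subset by blast
  have \<Omega>: "\<Omega> \<noteq> {}" using E by auto
  interpret prob_space ?M using fin \<Omega> by (rule prob_space_uniform_count_measure)
  have mE: "emeasure ?M E \<noteq> 0" "emeasure ?M E \<noteq> \<infinity>"
    using E E' fin \<Omega> by (auto simp: emeasure_uniform_count_measure)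
  have "measure (uniform_measure ?M E) A = card (A \<inter> E) / card E" if "A \<subseteq> \<Omega>" for A
  proof -
    have "measure (uniform_measure ?M E) A = measure ?M (E \<inter> A) / measure ?M E"
      using that mE E by (intro measure_uniform_measure) (auto simp: sets_uniform_count_measure)
    also have "\<dots> = card (A \<inter> E) / card E"
      using that E fin \<Omega>
      by (subst (1 2) measure_uniform_count_measure) (auto simp: Int_commute)
    finally show ?thesis .
  qed
  moreover have "prob_space (uniform_measure ?M E)"
    using mE by (intro prob_space_uniform_measure) auto
  ultimately show ?thesis
    using fin E by (auto simp: uniform_on_def space_uniform_count_measure sets_uniform_count_measure)
qed

lemma uniform_on_prob:
  assumes "uniform_on P E"
  shows "\<P>(\<omega> in P. Q \<omega>) = card {\<omega>\<in>E. Q \<omega>} / card E"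
proof -
  have "\<forall>A\<subseteq>space P. measure P A = card (A \<inter> E) / card E"
    using assms by (simp add: uniform_on_def)
  then have "\<P>(\<omega> in P. Q \<omega>) = card ({\<omega>\<in>space P. Q \<omega>} \<inter> E) / card E"
    by simp
  also have "{\<omega>\<in>space P. Q \<omega>} \<inter> E = {\<omega>\<in>E. Q \<omega>}"
    using assms by (auto simp: uniform_on_def)
  finally show ?thesis .
qed

lemma uniform_on_finite: "uniform_on P E \<Longrightarrow> finite E \<and> E \<noteq> {}"
  using finite_subset by (auto simp: uniform_on_def)

text \<open>Probabilities are counts divided by \<open>card E\<close>. Multiplying independence by
  the square of \<open>card E\<close> gives an identity of natural numbers.\<close>

lemma uniform_on_mutual_info_eq_0_iff:
  assumes P: "uniform_on P E"
  shows "mutual_info P X Y = 0 \<longleftrightarrow> (\<forall>x y.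
    card {\<omega>\<in>E. X \<omega> = x \<and> Y \<omega> = y} * card E = card {\<omega>\<in>E. X \<omega> = x} * card {\<omega>\<in>E. Y \<omega> = y})"
proof -
  have ps: "prob_space P" "finite (space P)" "sets P = Pow (space P)"
    using P by (auto simp: uniform_on_def)
  have "card E > 0" using uniform_on_finite[OF P] by (auto simp: card_gt_0_iff)
  then have "real a / card E = (b / card E) * (c / card E) \<longleftrightarrow> a * card E = b * c" for a b c :: nat
    by (auto simp: field_simps simp flip: of_nat_mult)
  then show ?thesis
    unfolding prob_space.mutual_info_eq_0_iff[OF ps] uniform_on_prob[OF P] by simp
qed

section \<open>Error-free maximum likelihood decoding\<close>

lemma uniform_on_ml_error_eq_0_iff:
  assumes P: "uniform_on P E"
  shows "ml_error P V X Y = 0 \<longleftrightarrow> (\<forall>\<omega>\<in>E. ml_decoder P V X Y (Y \<omega>) = X \<omega>)"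
proof -
  have "ml_error P V X Y = 0 \<longleftrightarrow> card {\<omega>\<in>E. ml_decoder P V X Y (Y \<omega>) \<noteq> X \<omega>} = 0"
    unfolding ml_error_def uniform_on_prob[OF P] using uniform_on_finite[OF P] by simp
  also have "\<dots> \<longleftrightarrow> {\<omega>\<in>E. ml_decoder P V X Y (Y \<omega>) \<noteq> X \<omega>} = {}"
    using uniform_on_finite[OF P] by (subst card_0_eq) auto
  finally show ?thesis by blast
qed

text \<open>If the observation determines \<open>X\<close>, the true value has positive likelihood
  and every other value has likelihood 0. The maximiser is unique, so the way ties are broken cannot
  matter.\<close>

lemma uniform_on_ml_decoder_eq:
  assumes P: "uniform_on P E" and \<omega>: "\<omega> \<in> E" "X \<omega> \<in> V"
    and dec: "\<And>\<omega>'. \<omega>' \<in> E \<Longrightarrow> Y \<omega>' = Y \<omega> \<Longrightarrow> X \<omega>' = X \<omega>"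
  shows "ml_decoder P V X Y (Y \<omega>) = X \<omega>"
proof -
  let ?L = "\<lambda>x. \<P>(\<omega>' in P. Y \<omega>' = Y \<omega> \<bar> X \<omega>' = x)"
  have E: "finite E" using uniform_on_finite[OF P] by simp
  \<comment> \<open>This includes values \<open>x\<close> of probability 0, where the conditional
    probability is 0 by the convention for division by 0.\<close>
  have zero: "?L x = 0" if "x \<noteq> X \<omega>" for x
  proof -
    have "{\<omega>'\<in>E. Y \<omega>' = Y \<omega> \<and> X \<omega>' = x} = {}" using dec that by auto
    then have "\<P>(\<omega>' in P. Y \<omega>' = Y \<omega> \<and> X \<omega>' = x) = 0" by (simp only: uniform_on_prob[OF P]) simp
    then show ?thesis by (simp add: cond_prob_def)
  qed
  have pos: "?L (X \<omega>) > 0"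
    using E \<omega> by (auto simp: cond_prob_def uniform_on_prob[OF P] card_gt_0_iff intro!: divide_pos_pos)
  have "is_arg_max ?L (\<lambda>x. x \<in> V) x \<longleftrightarrow> x = X \<omega>" for x
  proof
    assume "is_arg_max ?L (\<lambda>x. x \<in> V) x"
    then have "\<not> ?L x < ?L (X \<omega>)" using \<omega>(2) by (auto simp: is_arg_max_def)
    then show "x = X \<omega>" using zero[of x] pos by linarith
  next
    assume "x = X \<omega>"
    moreover have "\<not> ?L (X \<omega>) < ?L y" for y
      using zero[of y] pos by (cases "y = X \<omega>") auto
    ultimately show "is_arg_max ?L (\<lambda>x. x \<in> V) x"
      using \<omega>(2) by (auto simp: is_arg_max_def)
  qed
  then show ?thesis by (simp add: ml_decoder_def arg_max_def)
qed

section \<open>Equidistribution over a finite set\<close>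

lemma count_image_mset_mset_set:
  assumes "finite U"
  shows "count (image_mset f (mset_set U)) y = card {u\<in>U. f u = y}"
  using assms
proof (induction U)
  case (insert x U)
  have "{u \<in> insert x U. f u = y} = (if f x = y then insert x {u\<in>U. f u = y} else {u\<in>U. f u = y})"
    by auto
  with insert show ?case by simp
qed simp

text \<open>Equality of distributions survives post-processing.\<close>

lemma image_mset_comp_eq:
  assumes "image_mset f M = image_mset g M"
  shows "image_mset (\<lambda>x. h (f x)) M = image_mset (\<lambda>x. h (g x)) M"
  using arg_cong[OF assms, of "image_mset h"] by (simp add: image_mset.compositionality comp_def)

text \<open>The coordinates of a uniform tuple are independent, so the multiplicity of a result
  \<open>t\<close> is the product of its multiplicities in the single coordinates.\<close>

lemma image_mset_mset_set_PiE_eq: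
  fixes f g :: "'i \<Rightarrow> 'u \<Rightarrow> 'b"
  assumes I: "finite I" and U: "finite U"
    and eq: "\<And>i. i \<in> I \<Longrightarrow> image_mset (f i) (mset_set U) = image_mset (g i) (mset_set U)"
  shows "image_mset (\<lambda>v. \<lambda>i\<in>I. f i (v i)) (mset_set (I \<rightarrow>\<^sub>E U)) =
    image_mset (\<lambda>v. \<lambda>i\<in>I. g i (v i)) (mset_set (I \<rightarrow>\<^sub>E U))"
proof (rule multiset_eqI)
  fix t
  have cnt: "count (image_mset (\<lambda>v. \<lambda>i\<in>I. h i (v i)) (mset_set (I \<rightarrow>\<^sub>E U))) t =
      (if t \<in> extensional I then \<Prod>i\<in>I. count (image_mset (h i) (mset_set U)) (t i) else 0)"
    for h :: "'i \<Rightarrow> 'u \<Rightarrow> 'b"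
  proof -
    \<comment> \<open>The fibre over an extensional \<open>t\<close> is a box with the coordinate
      fibres as sides; over any other \<open>t\<close> it is empty.\<close>
    have "{v \<in> I \<rightarrow>\<^sub>E U. (\<lambda>i\<in>I. h i (v i)) = t} =
        (if t \<in> extensional I then \<Pi>\<^sub>E i\<in>I. {u\<in>U. h i u = t i} else {})"
      by (auto simp: PiE_iff fun_eq_iff restrict_def extensional_def)
    then show ?thesis
      using I U by (simp add: count_image_mset_mset_set finite_PiE card_PiE)
  qed
  show "count (image_mset (\<lambda>v. \<lambda>i\<in>I. f i (v i)) (mset_set (I \<rightarrow>\<^sub>E U))) t =
      count (image_mset (\<lambda>v. \<lambda>i\<in>I. g i (v i)) (mset_set (I \<rightarrow>\<^sub>E U))) t"
    unfolding cnt by (simp add: eq)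
qed

section \<open>Secret sharing\<close>

text \<open>As \<open>U\<close> is uniform, an equality of image multisets is an equality of distributions.\<close>

definition perfect_sharing ::
    "nat set set \<Rightarrow> nat set set \<Rightarrow> nat \<Rightarrow> ('m, 'u, 's) nss \<Rightarrow> bool" where
  "perfect_sharing \<AA> \<BB> n \<Psi> \<longleftrightarrow> nss_protocol n \<Psi> \<and>
     (\<forall>A\<in>\<AA>. \<forall>l\<in>secrets \<Psi>. \<forall>l'\<in>secrets \<Psi>. \<forall>u\<in>rand \<Psi>. \<forall>u'\<in>rand \<Psi>.
        restrict (share \<Psi> l u) A = restrict (share \<Psi> l' u') A \<longrightarrow> l = l') \<and>
     (\<forall>B\<in>\<BB>. \<forall>l\<in>secrets \<Psi>. \<forall>l'\<in>secrets \<Psi>.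
        image_mset (\<lambda>u. restrict (share \<Psi> l u) B) (mset_set (rand \<Psi>)) =
        image_mset (\<lambda>u. restrict (share \<Psi> l' u) B) (mset_set (rand \<Psi>)))"

text \<open>Recoverability makes the secret a function of the view, so the decoder is always right.
  For secrecy, the number \<open>c l\<close> of seeds producing a view \<open>y\<close> is the same
  for all secrets, hence the joint counts factor.\<close>

lemma perfect_sharing_imp_csnss:
  assumes "perfect_sharing \<AA> \<BB> n \<Psi>"
  shows "csnss \<AA> \<BB> n \<Psi>"
proof -
  let ?E = "secrets \<Psi> \<times> rand \<Psi>"
  have prot: "nss_protocol n \<Psi>" using assms by (simp add: perfect_sharing_def)
  then have fin: "finite (secrets \<Psi>)" "secrets \<Psi> \<noteq> {}" "finite (rand \<Psi>)" "rand \<Psi> \<noteq> {}"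
    by (auto simp: nss_protocol_def)
  have P: "uniform_on (nss_space \<Psi>) ?E"
    unfolding nss_space_def using fin by (intro uniform_on_uniform_count_measure) auto
  have "nss_correct \<AA> \<Psi>"
    unfolding nss_correct_def uniform_on_ml_error_eq_0_iff[OF P]
  proof (intro ballI)
    fix A \<omega> assume A: "A \<in> \<AA>" and \<omega>: "\<omega> \<in> ?E"
    show "ml_decoder (nss_space \<Psi>) (secrets \<Psi>) fst (\<lambda>\<omega>. restrict (share_tuple \<Psi> \<omega>) A)
        (restrict (share_tuple \<Psi> \<omega>) A) = fst \<omega>"
    proof (rule uniform_on_ml_decoder_eq[OF P \<omega>])
      show "fst \<omega> \<in> secrets \<Psi>" using \<omega> by auto
      show "fst \<omega>' = fst \<omega>"
        if "\<omega>' \<in> ?E" "restrict (share_tuple \<Psi> \<omega>') A = restrict (share_tuple \<Psi> \<omega>) A" for \<omega>'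
      proof -
        obtain l u l' u' where "\<omega> = (l, u)" "\<omega>' = (l', u')" by (metis surj_pair)
        then show ?thesis
          using that \<omega> A assms unfolding perfect_sharing_def by (simp add: share_tuple_def) blast
      qed
    qed
  qed
  moreover have "nss_secret \<BB> \<Psi>"
    unfolding nss_secret_def uniform_on_mutual_info_eq_0_iff[OF P]
  proof (intro ballI allI)
    fix B x y assume B: "B \<in> \<BB>"
    define c where "c l = card {u\<in>rand \<Psi>. restrict (share \<Psi> l u) B = y}" for l
    let ?Y = "\<lambda>\<omega>. restrict (share_tuple \<Psi> \<omega>) B"
    have c: "c l = c l'" if "l \<in> secrets \<Psi>" "l' \<in> secrets \<Psi>" for l l'
    proof -
      have "image_mset (\<lambda>u. restrict (share \<Psi> l u) B) (mset_set (rand \<Psi>)) =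
          image_mset (\<lambda>u. restrict (share \<Psi> l' u) B) (mset_set (rand \<Psi>))"
        using assms that B unfolding perfect_sharing_def by blast
      from arg_cong[OF this, of "\<lambda>M. count M y"] show ?thesis
        by (simp only: c_def count_image_mset_mset_set[OF fin(3)])
    qed
    show "card {\<omega>\<in>?E. fst \<omega> = x \<and> ?Y \<omega> = y} * card ?E = card {\<omega>\<in>?E. fst \<omega> = x} * card {\<omega>\<in>?E. ?Y \<omega> = y}"
    proof (cases "x \<in> secrets \<Psi>")
      case False
      then have "{\<omega>\<in>?E. fst \<omega> = x \<and> ?Y \<omega> = y} = {}" "{\<omega>\<in>?E. fst \<omega> = x} = {}" by auto
      then show ?thesis by (simp only: card.empty)
    next
      case True
      have "{\<omega>\<in>?E. fst \<omega> = x \<and> ?Y \<omega> = y} = {x} \<times> {u\<in>rand \<Psi>. restrict (share \<Psi> x u) B = y}"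
        using True by (auto simp: share_tuple_def)
      then have 1: "card {\<omega>\<in>?E. fst \<omega> = x \<and> ?Y \<omega> = y} = c x"
        by (simp add: card_cartesian_product c_def)
      have "{\<omega>\<in>?E. fst \<omega> = x} = {x} \<times> rand \<Psi>" using True by auto
      then have 2: "card {\<omega>\<in>?E. fst \<omega> = x} = card (rand \<Psi>)"
        by (simp add: card_cartesian_product)
      have "{\<omega>\<in>?E. ?Y \<omega> = y} =
          (SIGMA l:secrets \<Psi>. {u\<in>rand \<Psi>. restrict (share \<Psi> l u) B = y})"
        by (auto simp: share_tuple_def)
      then have "card {\<omega>\<in>?E. ?Y \<omega> = y} = (\<Sum>l\<in>secrets \<Psi>. c l)"
        using fin by (simp add: c_def)
      also have "\<dots> = (\<Sum>l\<in>secrets \<Psi>. c x)" using True by (intro sum.cong c) auto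
      finally have 3: "card {\<omega>\<in>?E. ?Y \<omega> = y} = card (secrets \<Psi>) * c x" by simp
      show ?thesis by (simp add: 1 2 3 card_cartesian_product)
    qed
  qed
  ultimately show ?thesis using prot by (simp add: csnss_def)
qed

text \<open>Run \<open>N\<close> independent copies in parallel, one for each coordinate of a vector
  of secrets, and encode the vectors as natural numbers by bijections.\<close>

lemma perfect_sharing_power:
  fixes \<Psi> :: "('m, 'u, 's) nss"
  assumes \<AA>: "\<AA> \<subseteq> Pow {1..n}" and \<BB>: "\<BB> \<subseteq> Pow {1..n}"
    and \<Psi>: "perfect_sharing \<AA> \<BB> n \<Psi>" and N: "N \<ge> 1"
  obtains \<Psi>' :: "(nat, nat, nat) nss"
  where "perfect_sharing \<AA> \<BB> n \<Psi>'" "card (secrets \<Psi>') = card (secrets \<Psi>) ^ N"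
    "card (rand \<Psi>') = card (rand \<Psi>) ^ N" "\<And>j. card (shares \<Psi>' j) = card (shares \<Psi> j) ^ N"
proof -
  let ?L = "{..<N} \<rightarrow>\<^sub>E secrets \<Psi>" and ?U = "{..<N} \<rightarrow>\<^sub>E rand \<Psi>"
  let ?S = "\<lambda>j. {..<N} \<rightarrow>\<^sub>E shares \<Psi> j"
  have prot: "nss_protocol n \<Psi>" using \<Psi> by (simp add: perfect_sharing_def)
  then have fin: "finite (secrets \<Psi>)" "card (secrets \<Psi>) \<ge> 2" "finite (rand \<Psi>)" "rand \<Psi> \<noteq> {}"
    "\<And>j. j \<in> {1..n} \<Longrightarrow> finite (shares \<Psi> j)"
    by (auto simp: nss_protocol_def)
  have share: "share \<Psi> l u j \<in> shares \<Psi> j" if "l \<in> secrets \<Psi>" "u \<in> rand \<Psi>" "j \<in> {1..n}" for l u j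
    using prot that unfolding nss_protocol_def by (blast dest: PiE_mem)
  have cards: "card ?L = card (secrets \<Psi>) ^ N" "card ?U = card (rand \<Psi>) ^ N"
    "card (?S j) = card (shares \<Psi> j) ^ N" for j
    by (simp_all add: card_funcsetE)
  obtain eL where eL: "bij_betw eL {0..<card ?L} ?L"
    using ex_bij_betw_nat_finite[of ?L] fin by (auto intro: finite_PiE)
  obtain eU where eU: "bij_betw eU {0..<card ?U} ?U"
    using ex_bij_betw_nat_finite[of ?U] fin by (auto intro: finite_PiE)
  \<comment> \<open>Finiteness of the share sets is known only on \<open>{1..n}\<close>, so share
    encodings are chosen only there.\<close>
  have "\<exists>e. bij_betw e (?S j) {0..<card (?S j)}" if "j \<in> {1..n}" for j
    using ex_bij_betw_finite_nat[of "?S j"] fin(5)[OF that] by (auto intro: finite_PiE)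
  then obtain eS where eS: "\<And>j. j \<in> {1..n} \<Longrightarrow> bij_betw (eS j) (?S j) {0..<card (?S j)}"
    by metis
  \<comment> \<open>The uncoded share of player \<open>j\<close>: the vector of the shares received
    in the \<open>N\<close> copies.\<close>
  define v where "v l u j = (\<lambda>i\<in>{..<N}. share \<Psi> (l i) (u i) j)" for l u j
  have v: "v l u j \<in> ?S j" if "l \<in> ?L" "u \<in> ?U" "j \<in> {1..n}" for l u j
    using share[OF PiE_mem[OF that(1)] PiE_mem[OF that(2)] that(3)] by (simp add: v_def)
  define \<Psi>' :: "(nat, nat, nat) nss" where
    "\<Psi>' = \<lparr>secrets = {0..<card ?L}, rand = {0..<card ?U}, shares = (\<lambda>j. {0..<card (?S j)}),
      share = (\<lambda>l u. \<lambda>j\<in>{1..n}. eS j (v (eL l) (eU u) j))\<rparr>"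
  have eL_in: "eL l \<in> ?L" if "l \<in> secrets \<Psi>'" for l
    using that bij_betw_apply[OF eL, of l] by (simp only: \<Psi>'_def nss.simps)
  have eU_in: "eU u \<in> ?U" if "u \<in> rand \<Psi>'" for u
    using that bij_betw_apply[OF eU, of u] by (simp only: \<Psi>'_def nss.simps)
  have "nss_protocol n \<Psi>'"
    unfolding nss_protocol_def
  proof (intro conjI ballI)
    \<comment> \<open>\<open>N \<ge> 1\<close> matters here: the zeroth power would have a single
      secret.\<close>
    have "2 \<le> card (secrets \<Psi>) ^ 1" using fin by simp
    also have "\<dots> \<le> card (secrets \<Psi>) ^ N" using N fin by (intro power_increasing) auto
    finally show "2 \<le> card (secrets \<Psi>')" by (simp add: \<Psi>'_def cards)
    have "card (rand \<Psi>) > 0" using fin by (simp add: card_gt_0_iff)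
    then show "rand \<Psi>' \<noteq> {}" by (simp add: \<Psi>'_def cards)
    fix l u assume lu: "l \<in> secrets \<Psi>'" "u \<in> rand \<Psi>'"
    show "share \<Psi>' l u \<in> (\<Pi>\<^sub>E j\<in>{1..n}. shares \<Psi>' j)"
    proof (rule PiE_I)
      fix j assume j: "j \<in> {1..n}"
      have "eS j (v (eL l) (eU u) j) \<in> {0..<card (?S j)}"
        using bij_betwE[OF eS[OF j]] v[OF eL_in eU_in j] lu by blast
      then show "share \<Psi>' l u j \<in> shares \<Psi>' j" using j by (simp add: \<Psi>'_def)
    next
      fix j assume "j \<notin> {1..n}"
      then show "share \<Psi>' l u j = undefined" by (simp only: \<Psi>'_def nss.simps restrict_apply if_False)
    qed
  qed (simp_all add: \<Psi>'_def)
  moreover have "l = l'"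
    if A: "A \<in> \<AA>" and l: "l \<in> secrets \<Psi>'" "l' \<in> secrets \<Psi>'" and u: "u \<in> rand \<Psi>'" "u' \<in> rand \<Psi>'"
      and eq: "restrict (share \<Psi>' l u) A = restrict (share \<Psi>' l' u') A" for A l l' u u'
  proof -
    \<comment> \<open>Injectivity of \<open>eS j\<close> strips the encoding, and equal share
      vectors agree in every copy. Each copy then reveals its own coordinate of the secret.\<close>
    have *: "share \<Psi> (eL l i) (eU u i) j = share \<Psi> (eL l' i) (eU u' i) j" if i: "i < N" and j: "j \<in> A" for i j
    proof -
      have j': "j \<in> {1..n}" using A \<AA> j by blast
      have "eS j (v (eL l) (eU u) j) = eS j (v (eL l') (eU u') j)"
        using fun_cong[OF eq, of j] j j' by (simp add: \<Psi>'_def)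
      then have "v (eL l) (eU u) j = v (eL l') (eU u') j"
        using bij_betw_imp_inj_on[OF eS[OF j']] v[OF eL_in eU_in j'] l u by (blast dest: inj_onD)
      then show ?thesis using i by (auto simp: v_def dest: fun_cong[of _ _ i])
    qed
    have "eL l i = eL l' i" if i: "i < N" for i
    proof -
      have "restrict (share \<Psi> (eL l i) (eU u i)) A = restrict (share \<Psi> (eL l' i) (eU u' i)) A"
        using *[OF i] by (rule restrict_ext)
      moreover have "eL l i \<in> secrets \<Psi>" "eL l' i \<in> secrets \<Psi>" "eU u i \<in> rand \<Psi>" "eU u' i \<in> rand \<Psi>"
        using eL_in[OF l(1)] eL_in[OF l(2)] eU_in[OF u(1)] eU_in[OF u(2)] i by auto
      ultimately show ?thesis using \<Psi> A unfolding perfect_sharing_def by blast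
    qed
    then have "eL l = eL l'"
      using eL_in[OF l(1)] eL_in[OF l(2)] by (intro PiE_ext) auto
    then show ?thesis
      using bij_betw_imp_inj_on[OF eL] l by (auto simp: \<Psi>'_def dest: inj_onD)
  qed
  moreover have "image_mset (\<lambda>u. restrict (share \<Psi>' l u) B) (mset_set (rand \<Psi>')) =
      image_mset (\<lambda>u. restrict (share \<Psi>' l' u) B) (mset_set (rand \<Psi>'))"
    if B: "B \<in> \<BB>" and l: "l \<in> secrets \<Psi>'" "l' \<in> secrets \<Psi>'" for B l l'
  proof -
    \<comment> \<open>\<open>q\<close> collects the views of \<open>B\<close> in the single copies,
      and \<open>h\<close> regroups them by player and encodes them. As \<open>h\<close> depends on
      neither the secret nor the seeds, it suffices to compare the distributions of
      \<open>q\<close>, which reduces to single copies.\<close>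
    define h where "h w = (\<lambda>j\<in>B. eS j (\<lambda>i\<in>{..<N}. w i j))" for w :: "nat \<Rightarrow> nat \<Rightarrow> 's"
    define q where "q l = (\<lambda>u. \<lambda>i\<in>{..<N}. restrict (share \<Psi> (l i) (u i)) B)" for l u
    have B': "B \<subseteq> {1..n}" using B \<BB> by auto
    have share_eq: "restrict (share \<Psi>' l u) B = h (q (eL l) (eU u))" for l u
      using B' by (auto simp: fun_eq_iff restrict_def \<Psi>'_def h_def q_def v_def intro!: arg_cong[of _ _ "eS _"])
    have enc: "image_mset (\<lambda>u. restrict (share \<Psi>' l u) B) (mset_set (rand \<Psi>')) =
        image_mset (\<lambda>u. h (q (eL l) u)) (mset_set ?U)" for l
    proof -
      \<comment> \<open>Relabelling the seeds along a bijection keeps them uniform.\<close>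
      have "image_mset eU (mset_set (rand \<Psi>')) = mset_set ?U"
        using eU by (subst image_mset_mset_set) (auto simp: \<Psi>'_def bij_betw_def)
      then have "image_mset (\<lambda>u. h (q (eL l) u)) (mset_set ?U) =
          image_mset (\<lambda>u. h (q (eL l) (eU u))) (mset_set (rand \<Psi>'))"
        by (metis (no_types, lifting) image_mset.compositionality comp_def image_mset_cong)
      then show ?thesis by (simp only: share_eq)
    qed
    have "image_mset (q (eL l)) (mset_set ?U) = image_mset (q (eL l')) (mset_set ?U)"
      unfolding q_def
    proof (rule image_mset_mset_set_PiE_eq)
      fix i assume i: "i \<in> {..<N}"
      have "eL l i \<in> secrets \<Psi>" "eL l' i \<in> secrets \<Psi>"
        using eL_in[OF l(1)] eL_in[OF l(2)] i by auto
      then show "image_mset (\<lambda>u. restrict (share \<Psi> (eL l i) u) B) (mset_set (rand \<Psi>)) =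
          image_mset (\<lambda>u. restrict (share \<Psi> (eL l' i) u) B) (mset_set (rand \<Psi>))"
        using \<Psi> B unfolding perfect_sharing_def by blast
    qed (use fin in auto)
    then show ?thesis unfolding enc by (rule image_mset_comp_eq)
  qed
  ultimately have "perfect_sharing \<AA> \<BB> n \<Psi>'" unfolding perfect_sharing_def by blast
  then show ?thesis by (rule that) (simp_all add: \<Psi>'_def cards)
qed

text \<open>In the power with exponent \<open>Suc i\<close> every logarithm is multiplied by
  \<open>Suc i\<close>, which cancels in both rates. The rates are thus constant along the sequence,
  while the number of secrets grows exponentially.\<close>

lemma perfect_sharing_imp_achievable:
  assumes \<AA>: "\<AA> \<subseteq> Pow {1..n}" and \<BB>: "\<BB> \<subseteq> Pow {1..n}" and \<Psi>: "perfect_sharing \<AA> \<BB> n \<Psi>"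
  shows "ss_rate_achievable \<AA> \<BB> n (randomness_rate \<Psi>) (ss_rate n \<Psi>)"
proof -
  have fin: "finite (secrets \<Psi>)" "card (secrets \<Psi>) \<ge> 2"
    using \<Psi> by (auto simp: perfect_sharing_def nss_protocol_def)
  have "\<exists>\<Psi>' :: (nat, nat, nat) nss. perfect_sharing \<AA> \<BB> n \<Psi>' \<and>
      card (secrets \<Psi>') = card (secrets \<Psi>) ^ Suc i \<and> card (rand \<Psi>') = card (rand \<Psi>) ^ Suc i \<and>
      (\<forall>j. card (shares \<Psi>' j) = card (shares \<Psi> j) ^ Suc i)" for i
    using perfect_sharing_power[OF \<AA> \<BB> \<Psi>, of "Suc i"] by auto
  then obtain \<Psi>' :: "nat \<Rightarrow> (nat, nat, nat) nss" where \<Psi>':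
    "\<And>i. perfect_sharing \<AA> \<BB> n (\<Psi>' i)"
    "\<And>i. card (secrets (\<Psi>' i)) = card (secrets \<Psi>) ^ Suc i"
    "\<And>i. card (rand (\<Psi>' i)) = card (rand \<Psi>) ^ Suc i"
    "\<And>i j. card (shares (\<Psi>' i) j) = card (shares \<Psi> j) ^ Suc i"
    by metis
  \<comment> \<open>At \<open>a = 0\<close> both sides are 0, because
    \<open>ln 0 = 0\<close>.\<close>
  have log_pow: "log 2 (real (a ^ Suc i)) = real (Suc i) * log 2 a" for a i :: nat
  proof (cases "a = 0")
    case False
    then show ?thesis using log_nat_power[of a 2 "Suc i"] by (simp only: of_nat_power)
  qed (simp add: log_def)
  have "randomness_rate (\<Psi>' i) = randomness_rate \<Psi>" for i
    unfolding randomness_rate_def \<Psi>' log_pow by (simp del: of_nat_Suc)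
  moreover have "ss_rate n (\<Psi>' i) = ss_rate n \<Psi>" for i
    unfolding ss_rate_def \<Psi>' log_pow sum_distrib_left[symmetric] by (simp del: of_nat_Suc)
  moreover have "filterlim (\<lambda>i. card (secrets (\<Psi>' i))) at_top sequentially"
  proof (rule filterlim_at_top_mono[OF filterlim_ident])
    have "i \<le> card (secrets \<Psi>) ^ Suc i" for i
    proof -
      have "i < 2 ^ i" by simp
      also have "(2::nat) ^ i \<le> card (secrets \<Psi>) ^ i" using fin by (intro power_mono) auto
      also have "\<dots> \<le> card (secrets \<Psi>) ^ Suc i" using fin by (intro power_increasing) auto
      finally show ?thesis by simp
    qed
    then show "\<forall>\<^sub>F i in sequentially. i \<le> card (secrets (\<Psi>' i))" by (simp add: \<Psi>' del: power_Suc)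
  qed
  ultimately show ?thesis
    unfolding ss_rate_achievable_def using perfect_sharing_imp_csnss[OF \<Psi>'(1)]
    by (intro exI[of _ \<Psi>']) simp
qed

section \<open>From retrieval to secret sharing\<close>

lemma spir_protocol_answer_tuple:
  assumes "spir_protocol n f \<Gamma>" "m \<in> {1..f} \<rightarrow>\<^sub>E files \<Gamma>" "u \<in> seeds \<Gamma>" "k \<in> {1..f}" "r \<in> user_rand \<Gamma>"
  shows "answer_tuple n \<Gamma> (m, u, k, r) \<in> (\<Pi>\<^sub>E j\<in>{1..n}. answers \<Gamma> j)"
proof -
  have "query \<Gamma> k r j \<in> queries \<Gamma> j" "distribute \<Gamma> u j \<in> server_rand \<Gamma> j" if "j \<in> {1..n}" for j
    using assms that unfolding spir_protocol_def by (blast dest: PiE_mem)+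
  then have "answer \<Gamma> j (query \<Gamma> k r j) m (distribute \<Gamma> u j) \<in> answers \<Gamma> j" if "j \<in> {1..n}" for j
    using assms that unfolding spir_protocol_def by blast
  then show ?thesis by (simp add: answer_tuple_def PiE_iff)
qed

lemma spir_protocol_finite:
  assumes "spir_protocol n f \<Gamma>"
  shows "finite ({1..f} \<rightarrow>\<^sub>E files \<Gamma>)" "{1..f} \<rightarrow>\<^sub>E files \<Gamma> \<noteq> {}" "finite (files \<Gamma>)" "files \<Gamma> \<noteq> {}"
    "finite (seeds \<Gamma>)" "seeds \<Gamma> \<noteq> {}" "finite (user_rand \<Gamma>)" "user_rand \<Gamma> \<noteq> {}"
proof -
  show "finite (files \<Gamma>)" "files \<Gamma> \<noteq> {}"
    using assms by (auto simp: spir_protocol_def)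
  then show "finite ({1..f} \<rightarrow>\<^sub>E files \<Gamma>)" "{1..f} \<rightarrow>\<^sub>E files \<Gamma> \<noteq> {}"
    by (auto intro: finite_PiE simp: PiE_eq_empty_iff)
qed (use assms in \<open>auto simp: spir_protocol_def\<close>)

section \<open>Consequences of correctness and of the two secrecy conditions\<close>

lemma uniform_on_spir_cond_space:
  assumes "spir_protocol n f \<Gamma>" "k \<in> {1..f}" "r \<in> user_rand \<Gamma>"
  shows "uniform_on (spir_cond_space f \<Gamma> k r) (({1..f} \<rightarrow>\<^sub>E files \<Gamma>) \<times> seeds \<Gamma> \<times> {k} \<times> {r})"
proof -
  have "{\<omega> \<in> space (spir_space f \<Gamma>). file_index \<omega> = k \<and> user_randomness \<omega> = r} =
      ({1..f} \<rightarrow>\<^sub>E files \<Gamma>) \<times> seeds \<Gamma> \<times> {k} \<times> {r}"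
    using assms(2,3) by (auto simp: spir_space_def space_uniform_count_measure file_index_def user_randomness_def)
  then show ?thesis
    unfolding spir_cond_space_def spir_space_def
    using assms spir_protocol_finite[OF assms(1)]
    by (simp only:) (intro uniform_on_cond, auto)
qed

text \<open>Zero error means that the decoder is right at every outcome in \<open>?E\<close>. Its
  only input is the view of \<open>A\<close>, so equal views yield equal requested files, even under
  different seeds.\<close>

lemma spir_correct_decodes:
  assumes "spir_protocol n f \<Gamma>" "spir_correct \<AA> n f \<Gamma>" "A \<in> \<AA>" and kr: "k \<in> {1..f}" "r \<in> user_rand \<Gamma>"
    and m: "m \<in> {1..f} \<rightarrow>\<^sub>E files \<Gamma>" "m' \<in> {1..f} \<rightarrow>\<^sub>E files \<Gamma>" "u \<in> seeds \<Gamma>" "u' \<in> seeds \<Gamma>"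
    and eq: "restrict (answer_tuple n \<Gamma> (m, u, k, r)) A = restrict (answer_tuple n \<Gamma> (m', u', k, r)) A"
  shows "m k = m' k"
proof -
  let ?E = "({1..f} \<rightarrow>\<^sub>E files \<Gamma>) \<times> seeds \<Gamma> \<times> {k} \<times> {r}"
  note P = uniform_on_spir_cond_space[OF assms(1) kr]
  let ?d = "ml_decoder (spir_cond_space f \<Gamma> k r) (files \<Gamma>) (\<lambda>\<omega>. file_tuple \<omega> k)
    (\<lambda>\<omega>. restrict (answer_tuple n \<Gamma> \<omega>) A)"
  have "ml_error (spir_cond_space f \<Gamma> k r) (files \<Gamma>) (\<lambda>\<omega>. file_tuple \<omega> k)
      (\<lambda>\<omega>. restrict (answer_tuple n \<Gamma> \<omega>) A) = 0"
    using assms(2,3) kr unfolding spir_correct_def by blast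
  then have d: "?d (restrict (answer_tuple n \<Gamma> \<omega>) A) = file_tuple \<omega> k" if "\<omega> \<in> ?E" for \<omega>
    unfolding uniform_on_ml_error_eq_0_iff[OF P] using that by blast
  have "file_tuple (m, u, k, r) k = file_tuple (m', u', k, r) k"
    using d[of "(m, u, k, r)"] d[of "(m', u', k, r)"] m eq by simp
  then show ?thesis by (simp add: file_tuple_def)
qed

text \<open>
  Server secrecy only compares the answers averaged over the requested file.  Since the answers
  determine that file, each answer tuple arises from a single value of it, so the average is one
  term and the comparison holds for each value of the requested file.
\<close>

lemma spir_answers_depend_on_requested_file:
  assumes prot: "spir_protocol n f \<Gamma>" and corr: "spir_correct \<AA> n f \<Gamma>" and \<AA>: "\<AA> \<noteq> {}"
    and secret: "spir_server_secret n f \<Gamma>" and kr: "k \<in> {1..f}" "r \<in> user_rand \<Gamma>"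
    and m: "m \<in> {1..f} \<rightarrow>\<^sub>E files \<Gamma>" "m' \<in> {1..f} \<rightarrow>\<^sub>E files \<Gamma>" "m k = m' k"
  shows "image_mset (\<lambda>u. answer_tuple n \<Gamma> (m, u, k, r)) (mset_set (seeds \<Gamma>)) =
    image_mset (\<lambda>u. answer_tuple n \<Gamma> (m', u, k, r)) (mset_set (seeds \<Gamma>))"
proof (rule multiset_eqI)
  fix d
  let ?F = "{1..f} \<rightarrow>\<^sub>E files \<Gamma>"
  let ?E = "?F \<times> seeds \<Gamma> \<times> {k} \<times> {r}"
  let ?D = "answer_tuple n \<Gamma>"
  let ?W = "\<lambda>\<omega>. restrict (file_tuple \<omega>) ({1..f} - {k})"
  let ?w = "\<lambda>m. restrict m ({1..f} - {k})"
  obtain A where A: "A \<in> \<AA>" using \<AA> by auto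
  note fin = spir_protocol_finite[OF prot]
  note P = uniform_on_spir_cond_space[OF prot kr]
  \<comment> \<open>\<open>C\<close> counts seeds with all files fixed, whereas \<open>G\<close>
    also lets the requested file vary. Server secrecy controls \<open>G\<close>; the claim is about
    \<open>C\<close>.\<close>
  define C where "C m = card {u\<in>seeds \<Gamma>. ?D (m, u, k, r) = d}" for m
  define G where "G m = card {\<omega>\<in>?E. ?D \<omega> = d \<and> ?W \<omega> = ?w m}" for m
  have dec: "x k = x' k" if "x \<in> ?F" "x' \<in> ?F" "v \<in> seeds \<Gamma>" "v' \<in> seeds \<Gamma>"
    "?D (x, v, k, r) = d" "?D (x', v', k, r) = d" for x x' v v'
    using spir_correct_decodes[OF prot corr A kr that(1-4)] that(5,6) by simp
  have eq_ext: "x = y" if "x \<in> ?F" "y \<in> ?F" "x k = y k" "?w x = ?w y" for x y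
  proof (rule PiE_ext[OF that(1,2)])
    show "x i = y i" if "i \<in> {1..f}" for i
      using that \<open>x k = y k\<close> fun_cong[OF \<open>?w x = ?w y\<close>, of i] by (cases "i = k") auto
  qed
  \<comment> \<open>Once the other files are fixed, only the requested file and the seed are free,
    so this count does not depend on \<open>x\<close>. This lets the independence equations for
    \<open>m\<close> and \<open>m'\<close> be compared.\<close>
  have cardW: "card {\<omega>\<in>?E. ?W \<omega> = ?w x} = card (files \<Gamma>) * card (seeds \<Gamma>)" if x: "x \<in> ?F" for x
  proof -
    let ?g = "\<lambda>(a, u). (x(k := a), u, k, r)"
    have "{\<omega>\<in>?E. ?W \<omega> = ?w x} = ?g ` (files \<Gamma> \<times> seeds \<Gamma>)"
    proof (intro equalityI subsetI)
      fix \<omega> assume "\<omega> \<in> {\<omega>\<in>?E. ?W \<omega> = ?w x}"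
      then obtain y u where \<omega>: "\<omega> = (y, u, k, r)" "y \<in> ?F" "u \<in> seeds \<Gamma>" "?w y = ?w x"
        by (auto simp: file_tuple_def)
      have yk: "y k \<in> files \<Gamma>" using \<omega>(2) kr(1) by auto
      have "y = x(k := y k)"
      proof (rule eq_ext[OF \<omega>(2)])
        show "x(k := y k) \<in> ?F" using x yk kr(1) by (auto simp: PiE_iff extensional_def)
        show "?w y = ?w (x(k := y k))" using \<omega>(4) by (auto simp: fun_eq_iff restrict_def)
      qed simp
      then have "\<omega> = ?g (y k, u)" using \<omega>(1) by simp
      then show "\<omega> \<in> ?g ` (files \<Gamma> \<times> seeds \<Gamma>)" using yk \<omega>(3) by blast
    next
      fix \<omega> assume "\<omega> \<in> ?g ` (files \<Gamma> \<times> seeds \<Gamma>)"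
      then obtain a u where au: "\<omega> = (x(k := a), u, k, r)" "a \<in> files \<Gamma>" "u \<in> seeds \<Gamma>" by auto
      have "x(k := a) \<in> ?F" using x au(2) kr(1) by (auto simp: PiE_iff extensional_def)
      then show "\<omega> \<in> {\<omega>\<in>?E. ?W \<omega> = ?w x}"
        using au by (auto simp: file_tuple_def fun_eq_iff restrict_def)
    qed
    moreover have "inj_on ?g (files \<Gamma> \<times> seeds \<Gamma>)"
      by (auto simp: inj_on_def dest: fun_cong[of _ _ k])
    ultimately show ?thesis by (simp add: card_image card_cartesian_product)
  qed
  have "mutual_info (spir_cond_space f \<Gamma> k r) ?D ?W = 0"
    using secret kr unfolding spir_server_secret_def by blast
  then have "G x * card ?E = card {\<omega>\<in>?E. ?D \<omega> = d} * card {\<omega>\<in>?E. ?W \<omega> = ?w x}" for x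
    unfolding uniform_on_mutual_info_eq_0_iff[OF P] G_def by blast
  then have "G m * card ?E = G m' * card ?E" using cardW m(1,2) by simp
  moreover have "card ?E \<noteq> 0" using uniform_on_finite[OF P] by (simp only: card_eq_0_iff) simp
  ultimately have G_eq: "G m = G m'" by simp
  \<comment> \<open>The outcome given by \<open>y\<close> and \<open>v\<close> shows which requested
    file goes with the answers \<open>d\<close>. Every outcome counted by \<open>G x\<close> has
    that file and the other files of \<open>x\<close>, hence all the files of
    \<open>x\<close>.\<close>
  have C_eq_G: "C x = G x"
    if x: "x \<in> ?F" and y: "y \<in> ?F" "v \<in> seeds \<Gamma>" "?D (y, v, k, r) = d" "y k = x k" for x y v
  proof -
    have "{\<omega>\<in>?E. ?D \<omega> = d \<and> ?W \<omega> = ?w x} = (\<lambda>u. (x, u, k, r)) ` {u\<in>seeds \<Gamma>. ?D (x, u, k, r) = d}"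
    proof (intro equalityI subsetI)
      fix \<omega> assume "\<omega> \<in> {\<omega>\<in>?E. ?D \<omega> = d \<and> ?W \<omega> = ?w x}"
      then obtain z u where \<omega>: "\<omega> = (z, u, k, r)" "z \<in> ?F" "u \<in> seeds \<Gamma>" "?D (z, u, k, r) = d" "?w z = ?w x"
        by (auto simp: file_tuple_def)
      have "z k = x k" using dec[OF \<omega>(2) y(1) \<omega>(3) y(2) \<omega>(4) y(3)] y(4) by simp
      then have "z = x" using eq_ext \<omega>(2,5) x by blast
      then show "\<omega> \<in> (\<lambda>u. (x, u, k, r)) ` {u\<in>seeds \<Gamma>. ?D (x, u, k, r) = d}" using \<omega> by blast
    qed (use x in \<open>auto simp: file_tuple_def\<close>)
    then have "G x = card ((\<lambda>u. (x, u, k, r)) ` {u\<in>seeds \<Gamma>. ?D (x, u, k, r) = d})"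
      by (simp only: G_def)
    also have "\<dots> = C x" unfolding C_def by (intro card_image) (auto simp: inj_on_def)
    finally show ?thesis by simp
  qed
  have "C m = C m'"
  \<comment> \<open>If \<open>d\<close> never occurs with the requested file
    \<open>m k = m' k\<close>, both seed counts are 0.\<close>
  proof (cases "\<exists>y v. y \<in> ?F \<and> v \<in> seeds \<Gamma> \<and> ?D (y, v, k, r) = d \<and> y k = m k")
    case True
    then obtain y v where y: "y \<in> ?F" "v \<in> seeds \<Gamma>" "?D (y, v, k, r) = d" "y k = m k" by blast
    show ?thesis
      using C_eq_G[OF m(1) y] C_eq_G[OF m(2) y(1-3)] y(4) m(3) G_eq by simp
  next
    case False
    then have "{u\<in>seeds \<Gamma>. ?D (m, u, k, r) = d} = {}" "{u\<in>seeds \<Gamma>. ?D (m', u, k, r) = d} = {}"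
      using m by auto
    then show ?thesis by (simp only: C_def)
  qed
  then show "count (image_mset (\<lambda>u. ?D (m, u, k, r)) (mset_set (seeds \<Gamma>))) d =
      count (image_mset (\<lambda>u. ?D (m', u, k, r)) (mset_set (seeds \<Gamma>))) d"
    using fin by (simp add: count_image_mset_mset_set C_def)
qed

text \<open>The index \<open>k'\<close> and the view of \<open>B\<close> under \<open>k\<close> and
  \<open>r\<close> each have positive probability. Independence makes their joint probability
  positive, so some outcome with index \<open>k'\<close> shows this view, and its user randomness is
  \<open>r'\<close>.\<close>

lemma spir_user_secret_simulates:
  assumes prot: "spir_protocol n f \<Gamma>" and secret: "spir_user_secret \<BB> f \<Gamma>" and B: "B \<in> \<BB>"
    and k: "k \<in> {1..f}" "k' \<in> {1..f}" and r: "r \<in> user_rand \<Gamma>"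
  obtains r' where "r' \<in> user_rand \<Gamma>" "restrict (query \<Gamma> k' r') B = restrict (query \<Gamma> k r) B"
proof -
  let ?\<Omega> = "({1..f} \<rightarrow>\<^sub>E files \<Gamma>) \<times> seeds \<Gamma> \<times> {1..f} \<times> user_rand \<Gamma>"
  let ?Q = "\<lambda>\<omega>. restrict (query_tuple \<Gamma> \<omega>) B"
  let ?q = "restrict (query \<Gamma> k r) B"
  note fin = spir_protocol_finite[OF prot]
  have fin\<Omega>: "finite ?\<Omega>" using fin by simp
  have P: "uniform_on (spir_space f \<Gamma>) ?\<Omega>"
    unfolding spir_space_def
    using fin k by (intro uniform_on_uniform_count_measure fin\<Omega>) auto
  obtain m u where mu: "m \<in> {1..f} \<rightarrow>\<^sub>E files \<Gamma>" "u \<in> seeds \<Gamma>" using fin(2,6) by blast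
  have nz: "card {\<omega>\<in>?\<Omega>. H \<omega>} \<noteq> 0" if "\<omega> \<in> ?\<Omega>" "H \<omega>" for H \<omega>
  proof -
    have finite: "finite {\<omega>\<in>?\<Omega>. H \<omega>}" by (rule finite_subset[OF _ fin\<Omega>]) blast
    have "\<omega> \<in> {\<omega>\<in>?\<Omega>. H \<omega>}" using that by (intro CollectI conjI)
    then show ?thesis unfolding card_0_eq[OF finite] by (rule contrapos_pn) (simp only: empty_iff not_False_eq_True)
  qed
  have mult: "c \<noteq> 0" if "a \<noteq> 0" "b \<noteq> 0" "c * e = a * b" for a b c e :: nat
    using that by (metis mult_eq_0_iff)
  have "card {\<omega>\<in>?\<Omega>. file_index \<omega> = k'} \<noteq> 0"
    using mu k r by (intro nz[of "(m, u, k', r)"]) (simp_all add: file_index_def)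
  moreover have "card {\<omega>\<in>?\<Omega>. ?Q \<omega> = ?q} \<noteq> 0"
    using mu k r by (intro nz[of "(m, u, k, r)"]) (simp_all add: query_tuple_def)
  moreover have "card {\<omega>\<in>?\<Omega>. file_index \<omega> = k' \<and> ?Q \<omega> = ?q} * card ?\<Omega> =
      card {\<omega>\<in>?\<Omega>. file_index \<omega> = k'} * card {\<omega>\<in>?\<Omega>. ?Q \<omega> = ?q}"
    using secret B unfolding spir_user_secret_def uniform_on_mutual_info_eq_0_iff[OF P] by blast
  ultimately have "card {\<omega>\<in>?\<Omega>. file_index \<omega> = k' \<and> ?Q \<omega> = ?q} \<noteq> 0" by (rule mult)
  then have "{\<omega>\<in>?\<Omega>. file_index \<omega> = k' \<and> ?Q \<omega> = ?q} \<noteq> {}" by (rule contrapos_nn) (simp only: card.empty)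
  then show ?thesis by (auto simp: file_index_def query_tuple_def intro: that)
qed

text \<open>With \<open>r\<close> and the index 1 fixed, the queries are constants and the seed is
  the only randomness left. Secrets, seeds and shares range over the sets of the retrieval protocol,
  which makes the rates coincide.\<close>

lemma csspir_imp_perfect_sharing:
  assumes f: "f \<ge> 2" and \<BB>: "\<BB> \<subseteq> Pow {1..n}" and \<AA>: "\<AA> \<noteq> {}" and \<Gamma>: "csspir \<AA> \<BB> n f \<Gamma>"
    and r: "r \<in> user_rand \<Gamma>" and x: "x \<in> files \<Gamma>"
  defines "m \<equiv> \<lambda>l. \<lambda>i\<in>{1..f}. if i = 1 then l else x"
  shows "perfect_sharing \<AA> \<BB> n \<lparr>secrets = files \<Gamma>, rand = seeds \<Gamma>, shares = answers \<Gamma>,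
    share = (\<lambda>l u. answer_tuple n \<Gamma> (m l, u, 1, r))\<rparr>" (is "perfect_sharing _ _ _ ?\<Psi>")
proof -
  have prot: "spir_protocol n f \<Gamma>" and corr: "spir_correct \<AA> n f \<Gamma>"
    and server: "spir_server_secret n f \<Gamma>" and user: "spir_user_secret \<BB> f \<Gamma>"
    using \<Gamma> by (auto simp: csspir_def)
  note fin = spir_protocol_finite[OF prot]
  have 1: "1 \<in> {1..f}" and 2: "2 \<in> {1..f}" using f by auto
  have m: "m l \<in> {1..f} \<rightarrow>\<^sub>E files \<Gamma>" if "l \<in> files \<Gamma>" for l
    using that x by (auto simp: m_def)
  have nss: "nss_protocol n ?\<Psi>"
    using prot fin m spir_protocol_answer_tuple[OF prot _ _ 1 r]
    by (auto simp: nss_protocol_def spir_protocol_def)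
  have dec: "l = l'"
    if "A \<in> \<AA>" "l \<in> files \<Gamma>" "l' \<in> files \<Gamma>" "u \<in> seeds \<Gamma>" "u' \<in> seeds \<Gamma>"
      "restrict (answer_tuple n \<Gamma> (m l, u, 1, r)) A = restrict (answer_tuple n \<Gamma> (m l', u', 1, r)) A"
    for A l l' u u'
    using spir_correct_decodes[OF prot corr that(1) 1 r m m that(4-6)] that(2,3) 1
    by (simp add: m_def)
  have eq: "image_mset (\<lambda>u. restrict (answer_tuple n \<Gamma> (m l, u, 1, r)) B) (mset_set (seeds \<Gamma>)) =
      image_mset (\<lambda>u. restrict (answer_tuple n \<Gamma> (m l', u, 1, r)) B) (mset_set (seeds \<Gamma>))"
    if B: "B \<in> \<BB>" and l: "l \<in> files \<Gamma>" "l' \<in> files \<Gamma>" for B l l'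
  proof -
    obtain r' where r': "r' \<in> user_rand \<Gamma>" "restrict (query \<Gamma> 2 r') B = restrict (query \<Gamma> 1 r) B"
      using spir_user_secret_simulates[OF prot user B 1 2 r] .
    have q: "query \<Gamma> 1 r j = query \<Gamma> 2 r' j" if "j \<in> B" for j
      using fun_cong[OF r'(2), of j] that by simp
    \<comment> \<open>An answer depends on the index and the user randomness only through the query
      to that server. The two requests are therefore indistinguishable to \<open>B\<close> for any
      files and any seed.\<close>
    have sim: "restrict (answer_tuple n \<Gamma> (y, u, 1, r)) B = restrict (answer_tuple n \<Gamma> (y, u, 2, r')) B" for y u
      by (intro restrict_ext) (simp add: answer_tuple_def q del: One_nat_def)
    \<comment> \<open>Both entries are \<open>x\<close>, so the second request falls under the lemma
      on requested files although the first files differ.\<close>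
    have "m l 2 = m l' 2" using 2 by (simp add: m_def)
    from image_mset_comp_eq[OF spir_answers_depend_on_requested_file[OF prot corr \<AA> server 2 r'(1) m[OF l(1)] m[OF l(2)] this],
        of "\<lambda>d. restrict d B"]
    show ?thesis unfolding sim .
  qed
  show ?thesis
    unfolding perfect_sharing_def nss.simps
    by (intro conjI ballI impI; (rule nss | (rule eq; assumption) | (rule dec; assumption)))
qed

theorem corollary2:
  fixes n f :: nat
    and \<AA> \<BB> :: "nat set set"
    and \<Gamma> :: "('m, 'u, 'r, 't, 'q, 'd) spir"
    and R_PIR \<rho> :: real
  assumes "n \<ge> 1" and "f \<ge> 2"
    and "access_structure n \<AA> \<BB>" and "\<AA> \<noteq> {}"
    and "csspir \<AA> \<BB> n f \<Gamma>"
    and "pir_rate n \<Gamma> = R_PIR"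
    and "shared_randomness_rate \<Gamma> = \<rho>"
  shows "ss_rate_achievable \<AA> \<BB> n \<rho> R_PIR"
proof -
  have sub: "\<AA> \<subseteq> Pow {1..n}" "\<BB> \<subseteq> Pow {1..n}"
    using assms(3) by (auto simp: access_structure_def)
  have "spir_protocol n f \<Gamma>" using assms(5) by (simp add: csspir_def)
  from spir_protocol_finite[OF this]
  obtain r x where rx: "r \<in> user_rand \<Gamma>" "x \<in> files \<Gamma>" by blast
  from perfect_sharing_imp_achievable[OF sub csspir_imp_perfect_sharing[OF assms(2) sub(2) assms(4,5) rx]]
  show ?thesis
    using assms(6,7)
    by (simp add: ss_rate_def randomness_rate_def pir_rate_def shared_randomness_rate_def)
qed

end
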